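(* Let $\kappa$ and $\lambda$ be infinite cardinals with $\lambda^{<\kappa}=\lambda$. Then the following are equivalent: (1) $\kappa$ has the $\lambda$-filter extension property; (2) for every $\Gamma\le\lambda$ and every family $\{X_\gamma:\gamma<\Gamma\}$ of $(<\kappa)$-compact spaces with $w(X_\gamma)\le\lambda$ for all $\gamma$, the product $\prod_{\gamma<\Gamma}X_\gamma$ with the $(<\kappa)$-box topology is $(<\kappa)$-compact; (3) $2^\lambda$ is $(<\kappa)$-compact in the $(<\kappa)$-box topology.
   Context: All topological spaces are Hausdorff. A space is $(<\kappa)$-compact if every open cover has a subcover of cardinality $<\kappa$; $w(X)$ is the weight of $X$. For an infinite cardinal $\theta$, the $(<\theta)$-box topology on a product $\prod_\alpha X_\alpha$ has as a base the sets $\prod_\alpha O_\alpha$ with each $O_\alpha$ open in $X_\alpha$ and $|\{\alpha: O_\alpha\neq X_\alpha\}|<\theta$. $2^\lambda$ denotes the product of $\lambda$ copies of the discrete two-point space $\{0,1\}$ (also identified with the set of all functions $\lambda\to 2$, i.e. with $\mathscr{P}(\lambda)$). A filter $\mathscr{F}$ on a set $X$ is $(<\kappa)$-complete if the intersection of any subfamily of size $<\kappa$ lies in $\mathscr{F}$. A family $\mathscr{F}\subseteq\mathscr{P}(X)$ measures $A\subseteq X$ if $A\in\mathscr{F}$ or $X\setminus A\in\mathscr{F}$, and measures a family if it measures each of its members. For infinite cardinals $\kappa\le\lambda$, $\kappa$ has the $\lambda$-filter extension property if for every family $\mathscr{A}\subseteq\mathscr{P}(2^\lambda)$ with $|\mathscr{A}|\le\lambda$,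 every $(<\kappa)$-complete (proper) filter over the set $2^\lambda$ generated by at most $\lambda$ elements can be extended to a $(<\kappa)$-complete (proper) filter over $2^\lambda$ measuring $\mathscr{A}$. *)

theory Defs
  imports "HOL-Analysis.Analysis"
begin

unbundle cardinal_syntax

text \<open>
  Cardinals are well-orders \<open>r\<close> with \<open>Card_order r\<close>, as in the library; \<open>Field r\<close> is a set of that
  cardinality, and the elements below \<open>a\<close> form the initial segment \<open>underS r a\<close>. The cardinals
  \<open>\<kappa>\<close> and \<open>\<Lambda>\<close> (the usual \<open>\<lambda>\<close> is reserved syntax) may live on different types.
\<close>

text \<open>
  \<open>cexp_less \<Lambda> \<kappa>\<close> is the cardinality of the set of all functions from a proper initial segment of
  \<open>\<kappa>\<close> to \<open>\<Lambda>\<close>, that is, the sum of the powers of \<open>\<Lambda>\<close> to the cardinality of \<open>\<alpha>\<close> over all \<open>\<alpha> < \<kappa>\<close>.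
  For infinite \<open>\<kappa>\<close> and \<open>\<Lambda>\<close> this is also the supremum of the powers of \<open>\<Lambda>\<close> with exponent a
  cardinal \<open>\<mu> < \<kappa>\<close>; see \<open>cexp_less_eq_self_iff\<close>.
\<close>

definition cexp_less :: "'l rel \<Rightarrow> 'k rel \<Rightarrow> ('k \<times> ('k \<Rightarrow> 'l)) rel" where
  "cexp_less \<Lambda> \<kappa> = (CSUM a : \<kappa>. \<Lambda> ^c |underS \<kappa> a| )"

lemma cexp_less_eq_self_iff:
  fixes \<kappa> :: "'k rel" and \<Lambda> :: "'l rel"
  assumes \<kappa>: "Cinfinite \<kappa>" and \<Lambda>: "Cinfinite \<Lambda>"
  shows "cexp_less \<Lambda> \<kappa> =o \<Lambda> \<longleftrightarrow> (\<forall>\<mu> :: 'k rel. Card_order \<mu> \<and> \<mu> <o \<kappa> \<longrightarrow> \<Lambda> ^c \<mu> \<le>o \<Lambda>)"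
proof
  assume eq: "cexp_less \<Lambda> \<kappa> =o \<Lambda>"
  show "\<forall>\<mu> :: 'k rel. Card_order \<mu> \<and> \<mu> <o \<kappa> \<longrightarrow> \<Lambda> ^c \<mu> \<le>o \<Lambda>"
  proof (intro allI impI)
    fix \<mu> :: "'k rel"
    assume \<mu>: "Card_order \<mu> \<and> \<mu> <o \<kappa>"
    then obtain a where a: "a \<in> Field \<kappa>" and iso: "\<mu> =o Restr \<kappa> (underS \<kappa> a)"
      using ordLess_iff_ordIso_Restr[of \<kappa> \<mu>] \<kappa> by (auto simp: card_order_on_def)
    have "Field (Restr \<kappa> (underS \<kappa> a)) = underS \<kappa> a"
    proof (rule Refl_Field_Restr2)
      show "Refl \<kappa>"
        using \<kappa> by (simp add: card_order_on_def order_on_defs)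
      show "underS \<kappa> a \<subseteq> Field \<kappa>"
        by (auto simp: underS_def Field_def)
    qed
    then have "|Field \<mu>| =o |underS \<kappa> a|"
      using card_of_cong[OF iso] by simp
    then have eq': "\<mu> =o |underS \<kappa> a|"
      using \<mu> card_of_Field_ordIso ordIso_symmetric ordIso_transitive by blast
    have "\<Lambda> ^c \<mu> =o \<Lambda> ^c |underS \<kappa> a|"
      by (rule cexp_cong2[OF eq']) (use \<mu> \<Lambda> in auto)
    also have "\<Lambda> ^c |underS \<kappa> a| \<le>o cexp_less \<Lambda> \<kappa>"
    proof -
      let ?g = "\<lambda>f. (a, f)"
      have "inj_on ?g (Field (\<Lambda> ^c |underS \<kappa> a| ))" by (auto simp: inj_on_def)
      moreover have "?g ` Field (\<Lambda> ^c |underS \<kappa> a| ) \<subseteq> (SIGMA i : Field \<kappa>. Field (\<Lambda> ^c |underS \<kappa> i| ))"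
        using a by auto
      ultimately have "|Field (\<Lambda> ^c |underS \<kappa> a| )| \<le>o cexp_less \<Lambda> \<kappa>"
        unfolding cexp_less_def Csum_def by (meson card_of_ordLeq)
      then show ?thesis
        using card_of_Field_ordIso[OF Card_order_cexp] ordIso_symmetric ordIso_ordLeq_trans by blast
    qed
    also note eq
    finally show "\<Lambda> ^c \<mu> \<le>o \<Lambda>" .
  qed
next
  assume H: "\<forall>\<mu> :: 'k rel. Card_order \<mu> \<and> \<mu> <o \<kappa> \<longrightarrow> \<Lambda> ^c \<mu> \<le>o \<Lambda>"
  have two: "ctwo \<le>o \<Lambda>"
    using \<Lambda> by (simp add: ctwo_ordLeq_Cinfinite)
  have le: "\<kappa> \<le>o \<Lambda>"
  proof (rule ccontr)
    assume "\<not> \<kappa> \<le>o \<Lambda>"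
    then have less: "\<Lambda> <o \<kappa>"
      using \<kappa> \<Lambda> by (simp add: card_order_on_def not_ordLeq_iff_ordLess)
    then have "|Field \<Lambda>| <o \<kappa>"
      using \<Lambda> card_of_Field_ordIso ordIso_ordLess_trans by blast
    then obtain B where B: "B \<subseteq> Field \<kappa>" "|Field \<Lambda>| =o |B|" "|B| <o \<kappa>"
      using internalize_card_of_ordLess[of "Field \<Lambda>" \<kappa>] ordIso_ordLess_trans ordIso_symmetric
      by (metis Field_card_of card_of_Field_ordIso card_of_cong ordLess_imp_ordLeq
          internalize_card_of_ordLeq \<kappa>)
    have 1: "\<Lambda> ^c |B| \<le>o \<Lambda>" using H B card_of_Card_order by blast
    have 2: "\<Lambda> \<le>o |B|"
      using B \<Lambda> card_of_Field_ordIso ordIso_symmetric ordIso_transitive ordIso_imp_ordLeq by blast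
    have "\<Lambda> ^c \<Lambda> \<le>o \<Lambda> ^c |B|"
      by (rule cexp_mono2_Cnotzero[OF 2]) (use \<Lambda> Cinfinite_Cnotzero in auto)
    then have "\<Lambda> ^c \<Lambda> \<le>o \<Lambda>" using 1 ordLeq_transitive by blast
    moreover have "\<Lambda> <o \<Lambda> ^c \<Lambda>"
      using two \<Lambda> ordLess_ctwo_cexp[of \<Lambda>] cexp_mono1[OF two, of \<Lambda>] ordLess_ordLeq_trans by blast
    ultimately show False using not_ordLess_ordLeq by blast
  qed
  have each: "\<Lambda> ^c |underS \<kappa> a| \<le>o \<Lambda>" if "a \<in> Field \<kappa>" for a
    using H card_of_underS[of \<kappa> a] that \<kappa> card_of_Card_order by blast
  have "cexp_less \<Lambda> \<kappa> \<le>o \<Lambda>"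
    unfolding cexp_less_def Csum_def
  proof (rule card_of_Sigma_ordLeq_infinite_Field)
    show "\<not> finite (Field \<Lambda>)" using \<Lambda> by (simp add: cinfinite_def)
    show "Card_order \<Lambda>" using \<Lambda> by simp
    show "|Field \<kappa>| \<le>o \<Lambda>"
      using le \<kappa> card_of_Field_ordIso ordIso_ordLeq_trans by blast
    show "\<forall>a\<in>Field \<kappa>. |Field (\<Lambda> ^c |underS \<kappa> a| )| \<le>o \<Lambda>"
      using each card_of_Field_ordIso[OF Card_order_cexp] ordIso_ordLeq_trans by blast
  qed
  moreover have "\<Lambda> \<le>o cexp_less \<Lambda> \<kappa>"
  proof -
    obtain b where "b \<in> Field \<kappa>" and b: "underS \<kappa> b \<noteq> {}"
    proof -
      obtain x where x: "x \<in> Field \<kappa>"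
        using \<kappa> by (metis cinfinite_def ex_in_conv finite.emptyI)
      then obtain y where "y \<noteq> x" "(x, y) \<in> \<kappa>"
        using infinite_Card_order_limit[of \<kappa> x] \<kappa> unfolding cinfinite_def by metis
      then have "y \<in> Field \<kappa>" "underS \<kappa> y \<noteq> {}"
        by (auto simp: Field_def underS_def)
      then show ?thesis using that by blast
    qed
    let ?g = "\<lambda>z. (b, \<lambda>i. if i \<in> underS \<kappa> b then z else undefined)"
    have "inj_on ?g (Field \<Lambda>)"
      using b by (auto simp: inj_on_def fun_eq_iff)
    moreover have "?g ` Field \<Lambda> \<subseteq> (SIGMA i : Field \<kappa>. Field (\<Lambda> ^c |underS \<kappa> i| ))"
      using \<open>b \<in> Field \<kappa>\<close> by (auto simp: cexp_def Func_def Field_card_of)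
    ultimately have "|Field \<Lambda>| \<le>o cexp_less \<Lambda> \<kappa>"
      unfolding cexp_less_def Csum_def by (meson card_of_ordLeq)
    then show ?thesis
      using \<Lambda> card_of_Field_ordIso ordIso_symmetric ordIso_ordLeq_trans by blast
  qed
  ultimately show "cexp_less \<Lambda> \<kappa> =o \<Lambda>" by (simp add: ordIso_iff_ordLeq)
qed

definition lt_compact_space :: "'k rel \<Rightarrow> 'a topology \<Rightarrow> bool" where
  "lt_compact_space \<kappa> X \<longleftrightarrow>
     (\<forall>\<U>. (\<forall>U\<in>\<U>. openin X U) \<and> \<Union>\<U> = topspace X \<longrightarrow>
          (\<exists>\<V>. \<V> \<subseteq> \<U> \<and> |\<V>| <o \<kappa> \<and> \<Union>\<V> = topspace X))"

definition base_of :: "'a topology \<Rightarrow> 'a set set \<Rightarrow> bool" where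
  "base_of X \<B> \<longleftrightarrow> openin X = arbitrary union_of (\<lambda>U. U \<in> \<B>)"

definition weight :: "'a topology \<Rightarrow> 'a set rel" where
  "weight X = |SOME \<B>. base_of X \<B> \<and> (\<forall>\<B>'. base_of X \<B>' \<longrightarrow> |\<B>| \<le>o |\<B>'| )|"

lemma base_of_openin: "base_of X {U. openin X U}"
  unfolding base_of_def openin_topology_base_unique by auto

lemma weight_ordLeq_iff:
  "weight X \<le>o r \<longleftrightarrow> (\<exists>\<B>. base_of X \<B> \<and> |\<B>| \<le>o r)"
proof
  let ?P = "\<lambda>\<B>. base_of X \<B> \<and> (\<forall>\<B>'. base_of X \<B>' \<longrightarrow> |\<B>| \<le>o |\<B>'| )"
  have "\<exists>\<B>. ?P \<B>"
    using exists_minim_Card_order[of "card_of ` {\<B>. base_of X \<B>}"] base_of_openin[of X]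
      card_of_Card_order by blast
  then have P: "?P (SOME \<B>. ?P \<B>)" by (rule someI_ex)
  show "\<exists>\<B>. base_of X \<B> \<and> |\<B>| \<le>o r" if "weight X \<le>o r"
    using P that unfolding weight_def by blast
  show "weight X \<le>o r" if "\<exists>\<B>. base_of X \<B> \<and> |\<B>| \<le>o r"
    using P that ordLeq_transitive unfolding weight_def by blast
qed

definition box_base :: "'k rel \<Rightarrow> ('i \<Rightarrow> 'a topology) \<Rightarrow> 'i set \<Rightarrow> ('i \<Rightarrow> 'a) set set" where
  "box_base \<theta> X I = {\<Pi>\<^sub>E i\<in>I. V i | V.
      (\<forall>i\<in>I. openin (X i) (V i)) \<and> |{i\<in>I. V i \<noteq> topspace (X i)}| <o \<theta>}"

definition box_topology :: "'k rel \<Rightarrow> ('i \<Rightarrow> 'a topology) \<Rightarrow> 'i set \<Rightarrow> ('i \<Rightarrow> 'a) topology" where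
  "box_topology \<theta> X I = topology_generated_by (box_base \<theta> X I)"

lemma base_of_box_topology:
  assumes "Cinfinite \<theta>"
  shows "base_of (box_topology \<theta> X I) (box_base \<theta> X I)"
proof -
  let ?B = "box_base \<theta> X I"
  have Int: "S \<inter> T \<in> ?B" if S: "S \<in> ?B" and T: "T \<in> ?B" for S T
  proof -
    obtain V where V: "S = (\<Pi>\<^sub>E i\<in>I. V i)" "\<forall>i\<in>I. openin (X i) (V i)"
        "|{i\<in>I. V i \<noteq> topspace (X i)}| <o \<theta>"
      using S unfolding box_base_def by blast
    obtain W where W: "T = (\<Pi>\<^sub>E i\<in>I. W i)" "\<forall>i\<in>I. openin (X i) (W i)"
        "|{i\<in>I. W i \<noteq> topspace (X i)}| <o \<theta>"
      using T unfolding box_base_def by blast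
    have "{i\<in>I. V i \<inter> W i \<noteq> topspace (X i)}
        \<subseteq> {i\<in>I. V i \<noteq> topspace (X i)} \<union> {i\<in>I. W i \<noteq> topspace (X i)}" by auto
    moreover have "|{i\<in>I. V i \<noteq> topspace (X i)} \<union> {i\<in>I. W i \<noteq> topspace (X i)}| <o \<theta>"
      by (rule card_of_Un_ordLess_infinite_Field) (use assms V W in \<open>auto simp: cinfinite_def\<close>)
    ultimately have "|{i\<in>I. V i \<inter> W i \<noteq> topspace (X i)}| <o \<theta>"
      using card_of_mono1 ordLeq_ordLess_trans by blast
    moreover have "S \<inter> T = (\<Pi>\<^sub>E i\<in>I. V i \<inter> W i)" using V W by (auto simp: PiE_Int)
    ultimately show ?thesis
      using V W unfolding box_base_def by (auto intro!: exI[of _ "\<lambda>i. V i \<inter> W i"])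
  qed
  have top: "istopology (arbitrary union_of (\<lambda>U. U \<in> ?B))"
    by (rule istopology_base) (rule Int)
  have "generate_topology_on ?B U \<longleftrightarrow> (arbitrary union_of (\<lambda>U. U \<in> ?B)) U" for U
  proof
    assume "generate_topology_on ?B U"
    then show "(arbitrary union_of (\<lambda>U. U \<in> ?B)) U"
    proof induction
      case Empty
      then show ?case by simp
    next
      case (Int a b)
      then show ?case using top unfolding istopology_def by blast
    next
      case (UN K)
      then show ?case using top unfolding istopology_def by blast
    next
      case (Basis s)
      then show ?case by (simp add: arbitrary_union_of_inc)
    qed
  next
    assume "(arbitrary union_of (\<lambda>U. U \<in> ?B)) U"
    then obtain \<U> where "\<U> \<subseteq> ?B" "\<Union>\<U> = U" by (auto simp: union_of_def arbitrary_def)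
    then show "generate_topology_on ?B U"
      by (metis generate_topology_on.Basis generate_topology_on.UN subsetD)
  qed
  then show ?thesis
    unfolding base_of_def box_topology_def by (auto simp: openin_topology_generated_by_iff)
qed

lemma topspace_box_topology:
  fixes X :: "'i \<Rightarrow> 'a topology"
  assumes "Cinfinite \<theta>"
  shows "topspace (box_topology \<theta> X I) = (\<Pi>\<^sub>E i\<in>I. topspace (X i))"
proof -
  have "|{} :: 'i set| <o \<theta>"
    by (rule Cfinite_ordLess_Cinfinite[OF _ assms])
      (use card_of_Card_order in \<open>auto simp: cfinite_def Field_card_of simp del: card_of_empty\<close>)
  then have "(\<Pi>\<^sub>E i\<in>I. topspace (X i)) \<in> box_base \<theta> X I"
    unfolding box_base_def by (auto intro!: exI[of _ "\<lambda>i. topspace (X i)"])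
  moreover have "S \<subseteq> (\<Pi>\<^sub>E i\<in>I. topspace (X i))" if "S \<in> box_base \<theta> X I" for S
  proof -
    obtain V where V: "S = (\<Pi>\<^sub>E i\<in>I. V i)" "\<forall>i\<in>I. openin (X i) (V i)"
      using \<open>S \<in> box_base \<theta> X I\<close> unfolding box_base_def by blast
    then show ?thesis using openin_subset by (metis PiE_mono)
  qed
  ultimately show ?thesis
    unfolding box_topology_def by auto
qed

definition two_power :: "'l rel \<Rightarrow> ('l \<Rightarrow> bool) set" where
  "two_power \<Lambda> = (\<Pi>\<^sub>E i\<in>Field \<Lambda>. UNIV)"

text \<open>
  A filter over a set \<open>S\<close> is a library filter \<open>F\<close> with \<open>F \<le> principal S\<close>, i.e. with \<open>S\<close> as a member.
  A set \<open>A\<close> is a member of \<open>F\<close> if \<open>\<forall>\<^sub>F x in F. x \<in> A\<close>. The order is reversed inclusion: \<open>G \<le> F\<close>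
  says that \<open>G\<close> extends \<open>F\<close>, \<open>F \<noteq> bot\<close> says that \<open>F\<close> is proper, and \<open>INF B\<in>\<B>. principal B\<close>
  is the filter generated by \<open>\<B>\<close>.
\<close>

definition lt_complete_filter :: "'k rel \<Rightarrow> 'a filter \<Rightarrow> bool" where
  "lt_complete_filter \<kappa> F \<longleftrightarrow>
     (\<forall>\<S>. |\<S>| <o \<kappa> \<and> (\<forall>A\<in>\<S>. \<forall>\<^sub>F x in F. x \<in> A) \<longrightarrow> (\<forall>\<^sub>F x in F. x \<in> \<Inter>\<S>))"

definition measures_family :: "'a set \<Rightarrow> 'a filter \<Rightarrow> 'a set set \<Rightarrow> bool" where
  "measures_family S F \<A> \<longleftrightarrow>
     (\<forall>A\<in>\<A>. (\<forall>\<^sub>F x in F. x \<in> A) \<or> (\<forall>\<^sub>F x in F. x \<in> S - A))"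

definition filter_extension_property :: "'k rel \<Rightarrow> 'l rel \<Rightarrow> bool" where
  "filter_extension_property \<kappa> \<Lambda> \<longleftrightarrow>
     (\<forall>\<A> F. \<A> \<subseteq> Pow (two_power \<Lambda>) \<and> |\<A>| \<le>o \<Lambda> \<and>
        F \<le> principal (two_power \<Lambda>) \<and> F \<noteq> bot \<and> lt_complete_filter \<kappa> F \<and>
        (\<exists>\<B>. \<B> \<subseteq> Pow (two_power \<Lambda>) \<and> |\<B>| \<le>o \<Lambda> \<and> F = (INF B\<in>\<B>. principal B)) \<longrightarrow>
        (\<exists>G. G \<le> F \<and> G \<noteq> bot \<and> lt_complete_filter \<kappa> G \<and> measures_family (two_power \<Lambda>) G \<A>))"

text \<open>
  Index sets of size at most \<open>\<Lambda>\<close> are taken inside the type carrying \<open>\<Lambda>\<close>, which contains a copy of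
  every \<open>\<Gamma> \<le> \<Lambda>\<close>. HOL cannot quantify over types inside a formula, so the type \<open>'x\<close> of points is a
  parameter. A Hausdorff space of weight at most \<open>\<Lambda>\<close> has at most as many points as there are subsets
  of \<open>Field \<Lambda>\<close>, so the instance \<open>'x = 'l set\<close> already covers all such spaces up to homeomorphism.
  A type with a single element carries only trivial spaces and is excluded where this is used.
\<close>

definition box_products_lt_compact :: "'x itself \<Rightarrow> 'k rel \<Rightarrow> 'l rel \<Rightarrow> bool" where
  "box_products_lt_compact (_ :: 'x itself) \<kappa> \<Lambda> \<longleftrightarrow>
     (\<forall>(I :: 'l set) (X :: 'l \<Rightarrow> 'x topology).
        |I| \<le>o \<Lambda> \<and>
        (\<forall>i\<in>I. Hausdorff_space (X i) \<and> lt_compact_space \<kappa> (X i) \<and> weight (X i) \<le>o \<Lambda>) \<longrightarrow>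
        lt_compact_space \<kappa> (box_topology \<kappa> X I))"

end

theory Submission
  imports Defs
begin

text \<open>
  From (1) to compactness: if an open cover by basic boxes has no subcover of size less than \<open>\<kappa>\<close>, the
  complements of the unions of small subfamilies generate a proper \<open>\<kappa>\<close>-complete filter. An
  extension measuring all preimages of basic open sets of the factors converges in each factor,
  because the factors are compact; so it contains some member of the cover, a contradiction.
  Conversely, a filter extension is read off a suitable point of the power of two.

  Both directions need \<open>\<kappa>\<close> to be regular, here in the form \<open>stable \<kappa>\<close>, which is not assumed but
  follows from either side. If \<open>\<kappa>\<close> is singular, then the power of two can be partitioned into \<open>\<kappa>\<close> clopen
  sets, and a \<open>\<kappa>\<close>-complete filter is closed under
  intersections of \<open>\<kappa>\<close> members, so that it cannot measure the coordinates of a set of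
  size \<open>\<kappa>\<close> without concentrating on a point.
\<close>

section \<open>Cardinal arithmetic for sets of size less than \<open>\<kappa>\<close>\<close>

lemma finite_card_of_ordLess:
  assumes "Cinfinite \<kappa>" "finite A"
  shows "|A| <o \<kappa>"
  using assms Cfinite_ordLess_Cinfinite[of "|A|" \<kappa>] card_of_Card_order[of A]
  by (auto simp: cfinite_def Field_card_of)

lemma card_of_image_ordLess: "|A| <o r \<Longrightarrow> |f ` A| <o r"
  using card_of_image ordLeq_ordLess_trans by blast

lemma card_of_ordLeq_Field:
  assumes "Card_order r" "|A| \<le>o r"
  obtains e where "inj_on e A" "e ` A \<subseteq> Field r"
proof -
  have "|A| \<le>o |Field r|"
    using assms card_of_Field_ordIso ordIso_symmetric ordLeq_ordIso_trans by blast
  then show ?thesis using that card_of_ordLeq[of A "Field r"] by blast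
qed

text \<open>A well-order below \<open>\<kappa>\<close> is isomorphic to a proper initial segment of
  it, and passing to fields keeps only the cardinality. This links small sets to the exponents over
  which \<open>cexp_less\<close> sums.\<close>

lemma card_of_ordLess_underS:
  assumes "Card_order \<kappa>" "|A| <o \<kappa>"
  obtains i where "i \<in> Field \<kappa>" "|A| =o |underS \<kappa> i|"
proof -
  obtain i where i: "i \<in> Field \<kappa>" and iso: "|A| =o Restr \<kappa> (underS \<kappa> i)"
    using ordLess_iff_ordIso_Restr[of \<kappa> "|A|"] assms card_of_Well_order[of A]
    by (auto simp: card_order_on_def)
  have "Field (Restr \<kappa> (underS \<kappa> i)) = underS \<kappa> i"
  proof (rule Refl_Field_Restr2)
    show "Refl \<kappa>" using assms by (simp add: card_order_on_def order_on_defs)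
    show "underS \<kappa> i \<subseteq> Field \<kappa>" by (auto simp: underS_def Field_def)
  qed
  then have "|A| =o |underS \<kappa> i|"
    using card_of_cong[OF iso] by (simp add: Field_card_of)
  with i that show ?thesis by blast
qed

text \<open>Every summand of \<open>cexp_less \<Lambda> \<kappa>\<close> contains a constant
  function, so the sum is at least as large as its index set.\<close>

lemma ordLeq_if_cexp_less_eq:
  assumes "Cinfinite \<kappa>" "Cinfinite \<Lambda>" "cexp_less \<Lambda> \<kappa> =o \<Lambda>"
  shows "\<kappa> \<le>o \<Lambda>"
proof -
  obtain z where z: "z \<in> Field \<Lambda>"
    using assms(2) by (metis cinfinite_def ex_in_conv finite.emptyI)
  let ?g = "\<lambda>i. (i, \<lambda>j. if j \<in> underS \<kappa> i then z else undefined)"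
  have "inj_on ?g (Field \<kappa>)" by (auto simp: inj_on_def)
  moreover have "?g ` Field \<kappa> \<subseteq> (SIGMA i : Field \<kappa>. Field (\<Lambda> ^c |underS \<kappa> i| ))"
    using z by (auto simp: cexp_def Func_def Field_card_of)
  ultimately have "|Field \<kappa>| \<le>o cexp_less \<Lambda> \<kappa>"
    unfolding cexp_less_def Csum_def by (meson card_of_ordLeq)
  then show ?thesis
    using assms card_of_Field_ordIso ordIso_symmetric ordIso_ordLeq_trans ordLeq_ordIso_trans
    by blast
qed

text \<open>A set of size less than \<open>\<kappa>\<close> is the range of a function on some
  \<open>underS \<kappa> i\<close>, and \<open>cexp_less\<close> counts these functions. In this
  form the hypothesis on powers bounds the families to which the filter extension property is
  applied.\<close>

lemma card_of_small_subsets_ordLeq: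
  assumes "Cinfinite \<kappa>" "Cinfinite \<Lambda>" "cexp_less \<Lambda> \<kappa> =o \<Lambda>"
    and "|Y| \<le>o \<Lambda>"
  shows "|{a. a \<subseteq> Y \<and> |a| <o \<kappa>}| \<le>o \<Lambda>"
proof -
  obtain e where e: "inj_on e Y" "e ` Y \<subseteq> Field \<Lambda>"
    using card_of_ordLeq_Field assms by blast
  let ?P = "SIGMA i : Field \<kappa>. Field (\<Lambda> ^c |underS \<kappa> i| )"
  have "{a. a \<subseteq> Y \<and> |a| <o \<kappa>} \<subseteq> (\<lambda>(i, f). inv_into Y e ` (f ` underS \<kappa> i)) ` ?P"
  proof safe
    fix a assume a: "a \<subseteq> Y" "|a| <o \<kappa>"
    obtain i where i: "i \<in> Field \<kappa>" "|a| =o |underS \<kappa> i|"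
      using card_of_ordLess_underS assms(1) a(2) by blast
    obtain b where b: "bij_betw b (underS \<kappa> i) a"
      using i(2) card_of_ordIso ordIso_symmetric by blast
    let ?f = "\<lambda>j. if j \<in> underS \<kappa> i then e (b j) else undefined"
    have "?f \<in> Field (\<Lambda> ^c |underS \<kappa> i| )"
      using e a b bij_betwE[OF b] by (auto simp: cexp_def Func_def Field_card_of)
    moreover have "inv_into Y e ` (?f ` underS \<kappa> i) = a"
    proof -
      have "?f ` underS \<kappa> i = e ` a" using b by (force simp: bij_betw_def)
      then show ?thesis using e(1) a(1) by (simp add: inv_into_image_cancel)
    qed
    ultimately show "a \<in> (\<lambda>(i, f). inv_into Y e ` (f ` underS \<kappa> i)) ` ?P"
      using i(1) by (intro image_eqI[of _ _ "(i, ?f)"]) auto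
  qed
  then have "|{a. a \<subseteq> Y \<and> |a| <o \<kappa>}| \<le>o cexp_less \<Lambda> \<kappa>"
    unfolding cexp_less_def Csum_def by (rule surj_imp_ordLeq)
  then show ?thesis using assms(3) ordLeq_ordIso_trans by blast
qed

section \<open>Complete filters: bases, transfer to the power of two, and regularity\<close>

lemma lt_complete_filter_eventually_ball:
  assumes "lt_complete_filter \<kappa> F" "|I| <o \<kappa>" "\<And>i. i \<in> I \<Longrightarrow> \<forall>\<^sub>F x in F. P i x"
  shows "\<forall>\<^sub>F x in F. \<forall>i\<in>I. P i x"
proof -
  have "\<forall>\<^sub>F x in F. x \<in> \<Inter>((\<lambda>i. {x. P i x}) ` I)"
    by (rule assms(1)[unfolded lt_complete_filter_def, rule_format])
      (use assms(3) card_of_image_ordLess[OF assms(2)] in auto)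
  then show ?thesis by simp
qed

text \<open>The empty subfamily shows that \<open>\<B>\<close> is nonempty and pairs show that it is
  directed, so the members of the filter are the supersets of base elements. For completeness,
  choose a base element below each of the given members and then one below all the chosen
  ones.\<close>

lemma
  fixes \<B> :: "'a set set"
  assumes \<kappa>: "Cinfinite \<kappa>"
    and base: "\<And>\<C>. \<C> \<subseteq> \<B> \<Longrightarrow> |\<C>| <o \<kappa> \<Longrightarrow> \<exists>B\<in>\<B>. B \<subseteq> \<Inter>\<C>"
  shows eventually_INF_lt_complete_base:
      "eventually P (INF B\<in>\<B>. principal B) \<longleftrightarrow> (\<exists>B\<in>\<B>. \<forall>x\<in>B. P x)"
    and lt_complete_filter_INF: "lt_complete_filter \<kappa> (INF B\<in>\<B>. principal B)"
proof -
  have ev: "eventually P (INF B\<in>\<B>. principal B) \<longleftrightarrow> (\<exists>B\<in>\<B>. \<forall>x\<in>B. P x)" for P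
  proof (subst eventually_INF_base)
    show "\<B> \<noteq> {}"
      using base[OF empty_subsetI finite_card_of_ordLess[OF \<kappa> finite.emptyI]] by blast
    fix a b assume "a \<in> \<B>" "b \<in> \<B>"
    then have "\<exists>B\<in>\<B>. B \<subseteq> \<Inter>{a, b}"
      by (intro base finite_card_of_ordLess[OF \<kappa>]) simp_all
    then show "\<exists>B\<in>\<B>. principal B \<le> inf (principal a) (principal b)"
      by simp
  qed (auto simp: eventually_principal)
  then show "eventually P (INF B\<in>\<B>. principal B) \<longleftrightarrow> (\<exists>B\<in>\<B>. \<forall>x\<in>B. P x)" .
  show "lt_complete_filter \<kappa> (INF B\<in>\<B>. principal B)"
    unfolding lt_complete_filter_def
  proof safe
    fix \<S> :: "'a set set"
    assume S: "|\<S>| <o \<kappa>" "\<forall>A\<in>\<S>. \<forall>\<^sub>F x in INF B\<in>\<B>. principal B. x \<in> A"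
    then obtain b where b: "\<And>A. A \<in> \<S> \<Longrightarrow> b A \<in> \<B> \<and> b A \<subseteq> A"
      unfolding ev by (metis subsetI)
    obtain B where B: "B \<in> \<B>" "B \<subseteq> \<Inter>(b ` \<S>)"
      using base[of "b ` \<S>"] b card_of_image_ordLess[OF S(1)] by blast
    moreover have "\<Inter>(b ` \<S>) \<subseteq> \<Inter>\<S>" using b by blast
    ultimately have "\<forall>x\<in>B. x \<in> \<Inter>\<S>" by (meson subsetD)
    then show "\<forall>\<^sub>F x in INF B\<in>\<B>. principal B. x \<in> \<Inter>\<S>"
      unfolding ev using B(1) by (rule bexI)
  qed
qed

text \<open>
  Sending a point \<open>y\<close> to the indicator function of the members of \<open>\<A> \<union> \<B>\<close> containing it moves the
  problem to the power of two. This map need not be injective, but all members of \<open>\<A> \<union> \<B>\<close> are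
  saturated with respect to it.
\<close>

lemma filter_extension_property_transfer:
  fixes \<kappa> :: "'k rel" and \<Lambda> :: "'l rel" and Y :: "'y set"
  assumes \<kappa>: "Cinfinite \<kappa>" and \<Lambda>: "Cinfinite \<Lambda>" and fep: "filter_extension_property \<kappa> \<Lambda>"
    and B: "\<B> \<subseteq> Pow Y" "{} \<notin> \<B>" "|\<B>| \<le>o \<Lambda>"
    and base: "\<And>\<C>. \<C> \<subseteq> \<B> \<Longrightarrow> |\<C>| <o \<kappa> \<Longrightarrow> \<exists>B\<in>\<B>. B \<subseteq> \<Inter>\<C>"
    and A: "\<A> \<subseteq> Pow Y" "|\<A>| \<le>o \<Lambda>"
  obtains G where "G \<noteq> bot" "lt_complete_filter \<kappa> G" "\<And>B. B \<in> \<B> \<Longrightarrow> \<forall>\<^sub>F y in G. y \<in> B"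
    "measures_family Y G \<A>"
proof -
  have "|\<A> \<union> \<B>| \<le>o \<Lambda>"
    using card_of_Un_ordLeq_infinite_Field A B \<Lambda> unfolding cinfinite_def by blast
  then obtain e where e: "inj_on e (\<A> \<union> \<B>)" "e ` (\<A> \<union> \<B>) \<subseteq> Field \<Lambda>"
    using card_of_ordLeq_Field \<Lambda> by blast
  define \<phi> where "\<phi> y = (\<lambda>i\<in>Field \<Lambda>. i \<in> e ` {C \<in> \<A> \<union> \<B>. y \<in> C})" for y
  have \<phi>_e: "\<phi> y (e C) \<longleftrightarrow> y \<in> C" if "C \<in> \<A> \<union> \<B>" for y C
  proof -
    have "e C \<in> Field \<Lambda>" using e(2) that by blast
    then have "\<phi> y (e C) \<longleftrightarrow> e C \<in> e ` {C \<in> \<A> \<union> \<B>. y \<in> C}" by (simp add: \<phi>_def)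
    also have "\<dots> \<longleftrightarrow> y \<in> C" using inj_on_image_mem_iff[OF e(1) that] that by auto
    finally show ?thesis .
  qed
  have sat: "\<phi> y \<in> \<phi> ` C \<longleftrightarrow> y \<in> C" if "C \<in> \<A> \<union> \<B>" for y C
    using \<phi>_e[OF that] by (metis imageE imageI)
  have \<phi>_in: "\<phi> y \<in> two_power \<Lambda>" for y
    by (auto simp: \<phi>_def two_power_def)
  define \<B>' where "\<B>' = (`) \<phi> ` \<B>"
  have base': "\<exists>B\<in>\<B>'. B \<subseteq> \<Inter>\<C>" if C: "\<C> \<subseteq> \<B>'" "|\<C>| <o \<kappa>" for \<C>
  proof -
    \<comment> \<open>Different members of \<open>\<B>\<close> may have the same image; taking one
      preimage for each member of \<open>\<C>\<close> keeps the subfamily small.\<close>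
    obtain \<D> where D: "\<D> \<subseteq> \<B>" "inj_on ((`) \<phi>) \<D>" "\<C> = (`) \<phi> ` \<D>"
      using C(1) unfolding \<B>'_def by (auto simp: subset_image_inj)
    have "|\<D>| \<le>o |\<C>|" using D card_of_ordLeq[of \<D> \<C>] by blast
    then have "|\<D>| <o \<kappa>" using C(2) ordLeq_ordLess_trans by blast
    then obtain B where "B \<in> \<B>" "B \<subseteq> \<Inter>\<D>" using base D(1) by blast
    then have "\<phi> ` B \<in> \<B>'" "\<phi> ` B \<subseteq> \<Inter>\<C>" unfolding \<B>'_def D(3) by blast+
    then show ?thesis by blast
  qed
  let ?F = "INF B\<in>\<B>'. principal B"
  have ev: "eventually P ?F \<longleftrightarrow> (\<exists>B\<in>\<B>. \<forall>y\<in>B. P (\<phi> y))" for P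
    using eventually_INF_lt_complete_base[OF \<kappa> base', of P] by (simp add: \<B>'_def)
  have B'_Pow: "\<B>' \<subseteq> Pow (two_power \<Lambda>)" using \<phi>_in by (auto simp: \<B>'_def)
  obtain B0 where B0: "B0 \<in> \<B>"
    using base[OF empty_subsetI finite_card_of_ordLess[OF \<kappa> finite.emptyI]] by blast
  have F1: "?F \<le> principal (two_power \<Lambda>)"
    unfolding le_principal ev using B0 \<phi>_in by blast
  have F2: "?F \<noteq> bot"
    unfolding trivial_limit_def ev using B(2) by (metis equals0I)
  have F3: "lt_complete_filter \<kappa> ?F"
    by (rule lt_complete_filter_INF[OF \<kappa> base'])
  have B'_card: "|\<B>'| \<le>o \<Lambda>"
    unfolding \<B>'_def using card_of_image B(3) ordLeq_transitive by blast
  have A'_Pow: "(`) \<phi> ` \<A> \<subseteq> Pow (two_power \<Lambda>)" using \<phi>_in by auto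
  have A'_card: "|(`) \<phi> ` \<A>| \<le>o \<Lambda>"
    using card_of_image A(2) ordLeq_transitive by blast
  obtain G' where G': "G' \<le> ?F" "G' \<noteq> bot" "lt_complete_filter \<kappa> G'"
      "measures_family (two_power \<Lambda>) G' ((`) \<phi> ` \<A>)"
    using fep[unfolded filter_extension_property_def, rule_format, of "(`) \<phi> ` \<A>" ?F]
      A'_Pow A'_card F1 F2 F3 B'_Pow B'_card by blast
  have G'_B: "\<forall>\<^sub>F z in G'. z \<in> \<phi> ` B" if "B \<in> \<B>" for B
  proof -
    have "\<forall>\<^sub>F z in ?F. z \<in> \<phi> ` B" unfolding ev using that by blast
    then show ?thesis using G'(1) filter_leD by blast
  qed
  have G'_Y: "\<forall>\<^sub>F z in G'. z \<in> \<phi> ` Y"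
    using G'_B[OF B0] by (rule eventually_mono) (use B0 B in auto)
  let ?G = "inf (filtercomap \<phi> G') (principal Y)"
  have ev_G: "eventually P ?G \<longleftrightarrow> (\<exists>Q. eventually Q G' \<and> (\<forall>y\<in>Y. Q (\<phi> y) \<longrightarrow> P y))" for P
    unfolding eventually_inf_principal eventually_filtercomap by blast
  show ?thesis
  proof (rule that)
    show "?G \<noteq> bot"
      unfolding trivial_limit_def ev_G
    proof
      assume "\<exists>Q. eventually Q G' \<and> (\<forall>y\<in>Y. Q (\<phi> y) \<longrightarrow> False)"
      then obtain Q where Q: "eventually Q G'" "\<forall>y\<in>Y. \<not> Q (\<phi> y)" by blast
      have "\<forall>\<^sub>F z in G'. False"
        using Q(1) G'_Y by eventually_elim (use Q(2) in auto)
      then show False using G'(2) by (simp add: trivial_limit_def)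
    qed
    show "lt_complete_filter \<kappa> ?G"
      unfolding lt_complete_filter_def
    proof safe
      fix \<S> :: "'y set set" assume S: "|\<S>| <o \<kappa>" "\<forall>A\<in>\<S>. \<forall>\<^sub>F y in ?G. y \<in> A"
      then obtain Q where Q: "\<And>A. A \<in> \<S> \<Longrightarrow> eventually (Q A) G'"
          "\<And>A y. A \<in> \<S> \<Longrightarrow> y \<in> Y \<Longrightarrow> Q A (\<phi> y) \<Longrightarrow> y \<in> A"
        unfolding ev_G by metis
      have "\<forall>\<^sub>F z in G'. \<forall>A\<in>\<S>. Q A z"
        by (rule lt_complete_filter_eventually_ball[OF G'(3) S(1) Q(1)])
      then show "\<forall>\<^sub>F y in ?G. y \<in> \<Inter>\<S>"
        unfolding ev_G using Q(2) by (intro exI[of _ "\<lambda>z. \<forall>A\<in>\<S>. Q A z"]) blast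
    qed
    show "\<forall>\<^sub>F y in ?G. y \<in> B" if "B \<in> \<B>" for B
      unfolding ev_G using G'_B[OF that] sat[of B] that by blast
    show "measures_family Y ?G \<A>"
      unfolding measures_family_def
    proof
      fix C assume C: "C \<in> \<A>"
      then consider "\<forall>\<^sub>F z in G'. z \<in> \<phi> ` C" | "\<forall>\<^sub>F z in G'. z \<in> two_power \<Lambda> - \<phi> ` C"
        using G'(4) unfolding measures_family_def by blast
      then show "(\<forall>\<^sub>F y in ?G. y \<in> C) \<or> (\<forall>\<^sub>F y in ?G. y \<in> Y - C)"
      proof cases
        case 1
        then show ?thesis unfolding ev_G using sat[of C] C by blast
      next
        case 2
        then show ?thesis unfolding ev_G using C by blast
      qed
    qed
  qed
qed

text \<open>
  If \<open>\<kappa>\<close> is singular, witnessed by \<open>T\<close>, then \<open>Pow T\<close> has size at most \<open>\<Lambda>\<close>, since a subset of \<open>T\<close> is a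
  union of few small sets. The filter of complements of sets of size at most \<open>|T|\<close> on \<open>Pow T\<close> has no
  complete extension measuring all sets \<open>{D. t \<in> D}\<close>.
\<close>

lemma stable_if_filter_extension_property:
  fixes \<kappa> :: "'k rel" and \<Lambda> :: "'l rel"
  assumes \<kappa>: "Cinfinite \<kappa>" and \<Lambda>: "Cinfinite \<Lambda>" and cexp: "cexp_less \<Lambda> \<kappa> =o \<Lambda>"
    and fep: "filter_extension_property \<kappa> \<Lambda>"
  shows "stable \<kappa>"
proof (rule ccontr)
  assume "\<not> stable \<kappa>"
  then obtain A :: "'k set" and F :: "'k \<Rightarrow> 'k set" where A: "|A| <o \<kappa>"
      and F: "\<And>a. a \<in> A \<Longrightarrow> |F a| <o \<kappa>" and large: "\<not> |Sigma A F| <o \<kappa>"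
    unfolding stable_def by blast
  define T where "T = Sigma A F"
  have \<kappa>_le_T: "\<kappa> \<le>o |T|"
    using large \<kappa> not_ordLess_iff_ordLeq[OF _ card_of_Well_order] unfolding T_def
    by (auto simp: card_order_on_def)
  have T_inf: "infinite T"
    using large finite_card_of_ordLess[OF \<kappa>] unfolding T_def by blast
  have "|T| \<le>o \<kappa>"
    unfolding T_def using \<kappa> A F
    by (intro card_of_Sigma_ordLeq_infinite_Field) (auto simp: cinfinite_def ordLess_imp_ordLeq)
  then have T_le: "|T| \<le>o \<Lambda>"
    using ordLeq_if_cexp_less_eq[OF \<kappa> \<Lambda> cexp] ordLeq_transitive by blast
  have Pow_T_le: "|Pow T| \<le>o \<Lambda>"
  proof -
    let ?S = "{a. a \<subseteq> T \<and> |a| <o \<kappa>}"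
    have "Pow T \<subseteq> \<Union> ` {s. s \<subseteq> ?S \<and> |s| <o \<kappa>}"
    proof
      fix D assume D: "D \<in> Pow T"
      let ?s = "(\<lambda>a. D \<inter> Pair a ` F a) ` A"
      have "|D \<inter> Pair a ` F a| <o \<kappa>" if "a \<in> A" for a
        using card_of_image_ordLess[OF F[OF that], of "Pair a"]
          card_of_mono1[of "D \<inter> Pair a ` F a" "Pair a ` F a"] ordLeq_ordLess_trans by blast
      then have "?s \<subseteq> ?S" using D by auto
      moreover have "|?s| <o \<kappa>" by (rule card_of_image_ordLess[OF A])
      moreover have "D = \<Union>?s" using D by (auto simp: T_def)
      ultimately show "D \<in> \<Union> ` {s. s \<subseteq> ?S \<and> |s| <o \<kappa>}" by blast
    qed
    then have "|Pow T| \<le>o |{s. s \<subseteq> ?S \<and> |s| <o \<kappa>}|" by (rule surj_imp_ordLeq)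
    \<comment> \<open>The count of small subsets is applied twice: to \<open>T\<close>, and then to
      the family \<open>?S\<close> of its small subsets.\<close>
    moreover have "|{s. s \<subseteq> ?S \<and> |s| <o \<kappa>}| \<le>o \<Lambda>"
      by (intro card_of_small_subsets_ordLeq \<kappa> \<Lambda> cexp T_le)
    ultimately show ?thesis using ordLeq_transitive by blast
  qed
  \<comment> \<open>A relation on \<open>T\<close> codes a family of at most \<open>|T|\<close>
    subsets of \<open>T\<close>, namely its sections. Coding the families to be removed in this way
    bounds the base by \<open>|Pow (T \<times> T)|\<close>, which is \<open>|Pow T|\<close>.\<close>
  let ?g = "\<lambda>R. (\<lambda>t. R `` {t}) ` T"
  define \<B> where "\<B> = (\<lambda>R. Pow T - ?g R) ` Pow (T \<times> T)"
  have \<B>_avoid: "\<exists>B\<in>\<B>. B \<subseteq> Pow T - D" if D: "D \<subseteq> Pow T" "|D| \<le>o |T|" for D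
  proof (cases "D = {}")
    case True
    then show ?thesis by (auto simp: \<B>_def)
  next
    case False
    then obtain h where h: "h ` T = D" using D(2) card_of_ordLeq2[of D T] by blast
    let ?R = "{(t, s). t \<in> T \<and> s \<in> h t}"
    have "?R \<in> Pow (T \<times> T)" using h D(1) by auto
    moreover have "?g ?R = D" using h by (auto simp: Image_def)
    ultimately show ?thesis unfolding \<B>_def by blast
  qed
  have \<B>_co: "|Pow T - B| \<le>o |T|" if "B \<in> \<B>" for B
  proof -
    from that obtain R where "B = Pow T - ?g R" unfolding \<B>_def by blast
    then have "Pow T - B \<subseteq> ?g R" by blast
    then show ?thesis by (rule surj_imp_ordLeq)
  qed
  have \<B>_Pow: "\<B> \<subseteq> Pow (Pow T)" by (auto simp: \<B>_def)
  \<comment> \<open>By Cantor's theorem, \<open>|T|\<close> subsets do not exhaust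
    \<open>Pow T\<close>.\<close>
  have \<B>_ne: "{} \<notin> \<B>"
    using \<B>_co[of "{}"] card_of_Pow[of T] not_ordLess_ordLeq by auto
  have \<B>_le: "|\<B>| \<le>o \<Lambda>"
  proof -
    obtain f where "bij_betw f (T \<times> T) T"
      using card_of_Times_same_infinite[OF T_inf] card_of_ordIso by blast
    then have "|Pow (T \<times> T)| =o |Pow T|"
      using bij_betw_Pow card_of_ordIso by blast
    moreover have "|\<B>| \<le>o |Pow (T \<times> T)|" unfolding \<B>_def by (rule card_of_image)
    ultimately show ?thesis using Pow_T_le ordLeq_ordIso_trans ordLeq_transitive by blast
  qed
  have base: "\<exists>B\<in>\<B>. B \<subseteq> \<Inter>\<C>" if C: "\<C> \<subseteq> \<B>" "|\<C>| <o \<kappa>" for \<C>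
  proof -
    let ?D = "\<Union>B\<in>\<C>. Pow T - B"
    have "|\<C>| \<le>o |T|" using C(2) \<kappa>_le_T ordLess_imp_ordLeq ordLeq_transitive by blast
    then have "|?D| \<le>o |T|"
      using \<B>_co C(1) by (intro card_of_UNION_ordLeq_infinite T_inf) auto
    moreover have "?D \<subseteq> Pow T" by blast
    ultimately obtain B where B: "B \<in> \<B>" "B \<subseteq> Pow T - ?D"
      using \<B>_avoid[of ?D] by (elim bexE[rotated]) auto
    have "B \<subseteq> \<Inter>\<C>" using B(2) by fast
    with B(1) show ?thesis by (rule rev_bexI)
  qed
  let ?A = "(\<lambda>t. {D \<in> Pow T. t \<in> D}) ` T"
  have A_Pow: "?A \<subseteq> Pow (Pow T)" by auto
  have A_le: "|?A| \<le>o \<Lambda>" using card_of_image T_le ordLeq_transitive by blast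
  obtain G where G: "G \<noteq> bot" "lt_complete_filter \<kappa> G" "\<And>B. B \<in> \<B> \<Longrightarrow> \<forall>\<^sub>F D in G. D \<in> B"
      "measures_family (Pow T) G ?A"
    using filter_extension_property_transfer[OF \<kappa> \<Lambda> fep \<B>_Pow \<B>_ne \<B>_le base A_Pow A_le]
    by blast
  \<comment> \<open>The only candidate for a point at which \<open>G\<close> could
    concentrate.\<close>
  define H where "H = {t \<in> T. \<forall>\<^sub>F D in G. t \<in> D}"
  have ev_H: "\<forall>\<^sub>F D in G. t \<in> D \<longleftrightarrow> t \<in> H" if t: "t \<in> T" for t
  proof -
    have "(\<forall>\<^sub>F D in G. D \<in> {D \<in> Pow T. t \<in> D}) \<or> (\<forall>\<^sub>F D in G. D \<in> Pow T - {D \<in> Pow T. t \<in> D})"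
      using G(4) t unfolding measures_family_def by blast
    then have "(\<forall>\<^sub>F D in G. t \<in> D) \<or> (\<forall>\<^sub>F D in G. t \<notin> D)"
      by (rule disj_forward; elim eventually_mono) auto
    then consider "\<forall>\<^sub>F D in G. t \<in> D" | "\<forall>\<^sub>F D in G. t \<notin> D" by blast
    then show ?thesis
    proof cases
      case 1
      then show ?thesis using t by (auto simp: H_def)
    next
      case 2
      have "t \<notin> H"
      proof
        assume "t \<in> H"
        then have "\<forall>\<^sub>F D in G. t \<in> D" by (simp add: H_def)
        with 2 have "\<forall>\<^sub>F D in G. False" by eventually_elim simp
        then show False using G(1) by (simp add: trivial_limit_def)
      qed
      then show ?thesis using 2 by simp
    qed
  qed
  \<comment> \<open>Completeness is used first over \<open>F a\<close> and then over
    \<open>A\<close>. Each time there are fewer than \<open>\<kappa>\<close> conditions, although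
    together they fix all of \<open>T\<close>; so \<open>{H}\<close> is a member of
    \<open>G\<close>, while the base avoids it.\<close>
  have ev_eq: "\<forall>\<^sub>F D in G. \<forall>a\<in>A. \<forall>b\<in>F a. (a, b) \<in> D \<longleftrightarrow> (a, b) \<in> H"
    using ev_H by (intro lt_complete_filter_eventually_ball[OF G(2)] A F) (auto simp: T_def)
  have "|{H}| \<le>o |T|"
    using finite_card_of_ordLess[OF \<kappa>, of "{H}"] \<kappa>_le_T ordLess_imp_ordLeq ordLeq_transitive
    by blast
  then obtain B where "B \<in> \<B>" and B: "B \<subseteq> Pow T - {H}"
    using \<B>_avoid[of "{H}"] by (auto simp: H_def)
  then have "\<forall>\<^sub>F D in G. D \<in> B" using G(3) by blast
  with ev_eq have "\<forall>\<^sub>F D in G. False"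
  proof eventually_elim
    case (elim D)
    then have "D \<subseteq> T" "D \<noteq> H" using B by auto
    moreover have "H \<subseteq> T" by (auto simp: H_def)
    ultimately show False using elim(1) unfolding T_def by auto
  qed
  then show False using G(1) by (simp add: trivial_limit_def)
qed

section \<open>Box topologies and compactness of the power of two\<close>

lemma base_of_imp_openin: "base_of X \<B> \<Longrightarrow> U \<in> \<B> \<Longrightarrow> openin X U"
  by (simp add: base_of_def arbitrary_union_of_inc)

lemma base_ofE:
  assumes "base_of X \<B>" "openin X U" "x \<in> U"
  obtains B where "B \<in> \<B>" "x \<in> B" "B \<subseteq> U"
  using assms unfolding base_of_def by (auto simp: union_of_def)

text \<open>This is a box with factors \<open>{p i}\<close> on \<open>J\<close> and \<open>S\<close>
  elsewhere; these sets serve as the neighbourhoods of \<open>p\<close> in the arguments about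
  powers.\<close>

lemma openin_box_topology_agree:
  assumes \<kappa>: "Cinfinite \<kappa>" and J: "J \<subseteq> I" "|J| <o \<kappa>" and p: "p \<in> I \<rightarrow>\<^sub>E S"
  shows "openin (box_topology \<kappa> (\<lambda>_. discrete_topology S) I) {q \<in> I \<rightarrow>\<^sub>E S. \<forall>i\<in>J. q i = p i}"
proof -
  let ?V = "\<lambda>i. if i \<in> J then {p i} else S"
  have "{q \<in> I \<rightarrow>\<^sub>E S. \<forall>i\<in>J. q i = p i} = (\<Pi>\<^sub>E i\<in>I. ?V i)"
  proof (intro equalityI subsetI)
    show "q \<in> (\<Pi>\<^sub>E i\<in>I. ?V i)" if "q \<in> {q \<in> I \<rightarrow>\<^sub>E S. \<forall>i\<in>J. q i = p i}" for q
      using that by (auto simp: PiE_iff)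
    show "q \<in> {q \<in> I \<rightarrow>\<^sub>E S. \<forall>i\<in>J. q i = p i}" if q: "q \<in> (\<Pi>\<^sub>E i\<in>I. ?V i)" for q
    proof -
      have "q i \<in> ?V i" if "i \<in> I" for i using q that by (rule PiE_mem)
      moreover have "p i \<in> S" if "i \<in> I" for i using p that by (rule PiE_mem)
      ultimately have "\<forall>i\<in>J. q i = p i" "\<forall>i\<in>I. q i \<in> S"
        using J(1) by (fastforce split: if_splits)+
      then show ?thesis using q by (simp add: PiE_iff)
    qed
  qed
  moreover have "|{i\<in>I. ?V i \<noteq> S}| <o \<kappa>"
  proof -
    have "{i\<in>I. ?V i \<noteq> S} \<subseteq> J" by auto
    then show ?thesis using J(2) card_of_mono1 ordLeq_ordLess_trans by blast
  qed
  moreover have "\<forall>i\<in>I. ?V i \<subseteq> S" using p by auto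
  ultimately have "{q \<in> I \<rightarrow>\<^sub>E S. \<forall>i\<in>J. q i = p i} \<in> box_base \<kappa> (\<lambda>_. discrete_topology S) I"
    unfolding box_base_def by (auto intro!: exI[of _ ?V])
  then show ?thesis using base_of_imp_openin base_of_box_topology[OF \<kappa>] by blast
qed

text \<open>
  If \<open>\<kappa>\<close> is singular, witnessed by \<open>T\<close>, there are \<open>|T| \<ge> \<kappa>\<close> points \<open>q t\<close> such that every point of the
  power has a neighbourhood containing at most one of them: the coordinates \<open>Inl a\<close> determine
  the first component of \<open>t\<close>, and few coordinates \<open>Inr t\<close> then determine the second.
\<close>

lemma stable_if_lt_compact_power:
  fixes \<kappa> :: "'k rel" and \<Lambda> :: "'l rel"
  assumes \<kappa>: "Cinfinite \<kappa>" and \<Lambda>: "Cinfinite \<Lambda>" and le: "\<kappa> \<le>o \<Lambda>" and xy: "x \<noteq> y"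
    and compact:
      "lt_compact_space \<kappa> (box_topology \<kappa> (\<lambda>_. discrete_topology {x, y}) (Field \<Lambda>))"
  shows "stable \<kappa>"
proof (rule ccontr)
  let ?X = "box_topology \<kappa> (\<lambda>_. discrete_topology {x, y}) (Field \<Lambda>)"
  have top: "topspace ?X = Field \<Lambda> \<rightarrow>\<^sub>E {x, y}"
    by (simp add: topspace_box_topology[OF \<kappa>])
  assume "\<not> stable \<kappa>"
  then obtain A :: "'k set" and F :: "'k \<Rightarrow> 'k set" where A: "|A| <o \<kappa>"
      and F: "\<And>a. a \<in> A \<Longrightarrow> |F a| <o \<kappa>" and large: "\<not> |Sigma A F| <o \<kappa>"
    unfolding stable_def by blast
  define T where "T = Sigma A F"
  have "|T| \<le>o \<kappa>"
    unfolding T_def using \<kappa> A F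
    by (intro card_of_Sigma_ordLeq_infinite_Field) (auto simp: cinfinite_def ordLess_imp_ordLeq)
  then have "|A <+> T| \<le>o \<kappa>"
    using \<kappa> A by (intro card_of_Plus_ordLeq_infinite_Field) (auto simp: cinfinite_def ordLess_imp_ordLeq)
  then have "|A <+> T| \<le>o \<Lambda>" using le ordLeq_transitive by blast
  then obtain e where e: "inj_on e (A <+> T)" "e ` (A <+> T) \<subseteq> Field \<Lambda>"
    using card_of_ordLeq_Field \<Lambda> by blast
  \<comment> \<open>The value \<open>x\<close> marks exactly two coordinates, one for the first
    component of \<open>t\<close> and one for \<open>t\<close> itself.\<close>
  define q where
    "q t = (\<lambda>i\<in>Field \<Lambda>. if i = e (Inl (fst t)) \<or> i = e (Inr t) then x else y)" for t
  have q_in: "q t \<in> Field \<Lambda> \<rightarrow>\<^sub>E {x, y}" for t by (auto simp: q_def)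
  have fst_T: "fst t \<in> A" if "t \<in> T" for t using that by (auto simp: T_def)
  have e_Inl: "e (Inl a) \<in> Field \<Lambda>" if "a \<in> A" for a using e(2) that by blast
  have e_Inr: "e (Inr t) \<in> Field \<Lambda>" if "t \<in> T" for t using e(2) that by blast
  have e_Inl_Inl: "e (Inl a) = e (Inl b) \<longleftrightarrow> a = b" if "a \<in> A" "b \<in> A" for a b
    using e(1) that by (auto dest: inj_onD)
  have e_Inr_Inr: "e (Inr t) = e (Inr u) \<longleftrightarrow> t = u" if "t \<in> T" "u \<in> T" for t u
    using e(1) that by (auto dest: inj_onD)
  have e_Inl_Inr: "e (Inl a) \<noteq> e (Inr t)" if "a \<in> A" "t \<in> T" for a t
    using e(1) that by (auto dest: inj_onD)
  have q_Inl: "q t (e (Inl a)) = x \<longleftrightarrow> a = fst t" if "t \<in> T" "a \<in> A" for t a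
    using that xy e_Inl fst_T e_Inl_Inl e_Inl_Inr by (simp add: q_def)
  have q_Inr: "q t (e (Inr u)) = x \<longleftrightarrow> u = t" if "t \<in> T" "u \<in> T" for t u
    using that xy e_Inr[OF that(2)] e_Inr_Inr[OF that(2,1)] e_Inl_Inr[OF fst_T[OF that(1)] that(2)]
    by (auto simp: q_def)
  \<comment> \<open>If these sets cover the power, a subcover must have at least \<open>|T|\<close>
    members.\<close>
  define \<U> where "\<U> = {W. openin ?X W \<and> (\<forall>t\<in>T. \<forall>u\<in>T. q t \<in> W \<and> q u \<in> W \<longrightarrow> t = u)}"
  have "\<exists>W\<in>\<U>. p \<in> W" if p: "p \<in> Field \<Lambda> \<rightarrow>\<^sub>E {x, y}" for p
  proof -
    \<comment> \<open>The indices compatible with \<open>p\<close> on the \<open>Inl\<close>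
      coordinates. Either there are none, or they all have the same first component \<open>a\<close>
      and number at most \<open>|F a|\<close>.\<close>
    define K where "K = {t \<in> T. \<forall>a\<in>A. p (e (Inl a)) = x \<longleftrightarrow> a = fst t}"
    have K: "|K| <o \<kappa>"
    proof (cases "K = {}")
      case True
      then show ?thesis using finite_card_of_ordLess[OF \<kappa>] by blast
    next
      case False
      then obtain t where "t \<in> K" by blast
      then obtain a where a: "a \<in> A" "\<forall>a'\<in>A. p (e (Inl a')) = x \<longleftrightarrow> a' = a"
        using fst_T[of t] by (auto simp: K_def)
      then have "K \<subseteq> Pair a ` F a" by (auto simp: K_def T_def)
      then show ?thesis
        using card_of_image_ordLess[OF F[OF a(1)], of "Pair a"] card_of_mono1 ordLeq_ordLess_trans
        by blast
    qed
    \<comment> \<open>Agreement with \<open>p\<close> on the \<open>Inl\<close> part forces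
      \<open>t\<close> into \<open>K\<close>; then the coordinate \<open>Inr t\<close> also lies in
      \<open>J\<close> and separates \<open>q t\<close> from every other \<open>q u\<close>.\<close>
    define J where "J = e ` (A <+> K)"
    have "|A <+> K| <o \<kappa>"
      using \<kappa> A K by (intro card_of_Plus_ordLess_infinite_Field) (auto simp: cinfinite_def)
    then have J_card: "|J| <o \<kappa>" unfolding J_def by (rule card_of_image_ordLess)
    have J_sub: "J \<subseteq> Field \<Lambda>" using e(2) by (auto simp: J_def K_def)
    let ?W = "{r \<in> Field \<Lambda> \<rightarrow>\<^sub>E {x, y}. \<forall>i\<in>J. r i = p i}"
    have "t = u" if t: "t \<in> T" "q t \<in> ?W" and u: "u \<in> T" "q u \<in> ?W" for t u
    proof -
      have "p (e (Inl a)) = x \<longleftrightarrow> a = fst t" if "a \<in> A" for a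
      proof -
        have "e (Inl a) \<in> J" using that by (auto simp: J_def)
        then have "p (e (Inl a)) = q t (e (Inl a))" using t(2) by simp
        then show ?thesis using q_Inl[OF t(1) that] by simp
      qed
      then have "t \<in> K" using t(1) by (simp add: K_def)
      then have tJ: "e (Inr t) \<in> J" by (auto simp: J_def)
      then have "q u (e (Inr t)) = q t (e (Inr t))" using t(2) u(2) by simp
      then show ?thesis using q_Inr[OF t(1) t(1)] q_Inr[OF u(1) t(1)] by simp
    qed
    then have "?W \<in> \<U>"
      unfolding \<U>_def using openin_box_topology_agree[OF \<kappa> J_sub J_card p] by blast
    then show ?thesis by (rule rev_bexI) (simp add: p)
  qed
  then have "topspace ?X \<subseteq> \<Union>\<U>" unfolding top by blast
  moreover have "\<Union>\<U> \<subseteq> topspace ?X"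
    using openin_subset[of ?X] by (intro Union_least) (simp add: \<U>_def)
  ultimately have "\<Union>\<U> = topspace ?X" by (rule equalityI[rotated])
  then obtain \<V> where V: "\<V> \<subseteq> \<U>" "|\<V>| <o \<kappa>" "\<Union>\<V> = topspace ?X"
    using compact[unfolded lt_compact_space_def, rule_format, of \<U>] by (auto simp: \<U>_def)
  have "\<forall>t\<in>T. \<exists>W\<in>\<V>. q t \<in> W" using V(3) q_in unfolding top by (metis UnionE)
  then obtain w where w: "\<And>t. t \<in> T \<Longrightarrow> w t \<in> \<V> \<and> q t \<in> w t" by metis
  have "inj_on w T"
  proof (rule inj_onI)
    fix t u assume "t \<in> T" "u \<in> T" "w t = w u"
    then show "t = u" using w[of t] w[of u] V(1) unfolding \<U>_def by auto
  qed
  then have "|T| \<le>o |\<V>|" using w card_of_ordLeq[of T \<V>] by blast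
  then show False using V(2) large ordLeq_ordLess_trans unfolding T_def by blast
qed

text \<open>
  A point of the power of two prescribes a side of each member of \<open>\<A>\<close>. If no point were suitable, every
  point would have a basic neighbourhood prescribing a null set, and fewer than \<open>\<kappa>\<close> null sets
  would cover everything.
\<close>

lemma filter_extension_property_if_lt_compact_power:
  fixes \<kappa> :: "'k rel" and \<Lambda> :: "'l rel"
  assumes \<kappa>: "Cinfinite \<kappa>" and \<Lambda>: "Cinfinite \<Lambda>" and st: "stable \<kappa>" and xy: "x \<noteq> y"
    and compact:
      "lt_compact_space \<kappa> (box_topology \<kappa> (\<lambda>_. discrete_topology {x, y}) (Field \<Lambda>))"
  shows "filter_extension_property \<kappa> \<Lambda>"
  unfolding filter_extension_property_def
proof (intro allI impI, elim conjE)
  let ?S = "two_power \<Lambda>"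
  fix \<A> :: "('l \<Rightarrow> bool) set set" and F :: "('l \<Rightarrow> bool) filter"
  assume A: "\<A> \<subseteq> Pow ?S" "|\<A>| \<le>o \<Lambda>" and F: "F \<le> principal ?S" "F \<noteq> bot" "lt_complete_filter \<kappa> F"
  obtain e where e: "inj_on e \<A>" "e ` \<A> \<subseteq> Field \<Lambda>"
    using card_of_ordLeq_Field \<Lambda> A(2) by blast
  let ?X = "box_topology \<kappa> (\<lambda>_. discrete_topology {x, y}) (Field \<Lambda>)"
  have top: "topspace ?X = Field \<Lambda> \<rightarrow>\<^sub>E {x, y}"
    by (simp add: topspace_box_topology[OF \<kappa>])
  \<comment> \<open>The points lying on the sides prescribed by \<open>p\<close> for the sets in
    \<open>a\<close>; the value \<open>x\<close> means inside.\<close>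
  define C where "C a p = {z. \<forall>A\<in>a. z \<in> A \<longleftrightarrow> p (e A) = x}" for a and p :: "'l \<Rightarrow> 'a"
  have "\<exists>p\<in>Field \<Lambda> \<rightarrow>\<^sub>E {x, y}. \<forall>a\<subseteq>\<A>. |a| <o \<kappa> \<longrightarrow> \<not> (\<forall>\<^sub>F z in F. z \<notin> C a p)"
  proof (rule ccontr)
    assume "\<not> ?thesis"
    then obtain a where a: "\<And>p. p \<in> Field \<Lambda> \<rightarrow>\<^sub>E {x, y} \<Longrightarrow>
        a p \<subseteq> \<A> \<and> |a p| <o \<kappa> \<and> (\<forall>\<^sub>F z in F. z \<notin> C (a p) p)"
      by metis
    define W where "W p = {q \<in> Field \<Lambda> \<rightarrow>\<^sub>E {x, y}. \<forall>i\<in>e ` a p. q i = p i}" for p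
    let ?P = "Field \<Lambda> \<rightarrow>\<^sub>E {x, y}"
    have W_open: "openin ?X (W p)" if "p \<in> ?P" for p
      unfolding W_def using a[OF that] e(2)
      by (intro openin_box_topology_agree[OF \<kappa> _ _ that] card_of_image_ordLess) blast+
    have "\<Union>(W ` ?P) = topspace ?X" unfolding top by (auto simp: W_def)
    then obtain \<V> where V: "\<V> \<subseteq> W ` ?P" "|\<V>| <o \<kappa>" "\<Union>\<V> = topspace ?X"
      using compact[unfolded lt_compact_space_def, rule_format, of "W ` ?P"] W_open by auto
    define g where "g = inv_into ?P W"
    have g: "g V \<in> ?P" "W (g V) = V" if "V \<in> \<V>" for V
      using V(1) that inv_into_into[of V W ?P] f_inv_into_f[of V W ?P] unfolding g_def by blast+
    have "\<forall>\<^sub>F z in F. \<forall>V\<in>\<V>. z \<notin> C (a (g V)) (g V)"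
      using a g(1) by (intro lt_complete_filter_eventually_ball[OF F(3) V(2)]) blast
    then obtain z where z: "\<And>V. V \<in> \<V> \<Longrightarrow> z \<notin> C (a (g V)) (g V)"
      using eventually_happens'[OF F(2)] by blast
    \<comment> \<open>This point records the sides on which \<open>z\<close> lies. Whichever
      neighbourhood of the subcover contains it, \<open>z\<close> lies in the null set attached to
      that neighbourhood.\<close>
    define q where "q = (\<lambda>i\<in>Field \<Lambda>. if \<exists>A\<in>\<A>. i = e A \<and> z \<in> A then x else y)"
    have q: "q (e A) = x \<longleftrightarrow> z \<in> A" if "A \<in> \<A>" for A
      using that e xy by (auto simp: q_def dest: inj_onD)
    have "q \<in> \<Union>\<V>" unfolding V(3) top by (auto simp: q_def)
    then obtain V where "V \<in> \<V>" "q \<in> W (g V)" using g(2) by auto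
    then have "z \<in> C (a (g V)) (g V)"
      using q a[OF g(1)] by (fastforce simp: W_def C_def)
    then show False using z \<open>V \<in> \<V>\<close> by blast
  qed
  then obtain p where p: "\<And>a. a \<subseteq> \<A> \<Longrightarrow> |a| <o \<kappa> \<Longrightarrow> \<not> (\<forall>\<^sub>F z in F. z \<notin> C a p)"
    by blast
  define \<B> where "\<B> = {B \<inter> C a p | B a. (\<forall>\<^sub>F z in F. z \<in> B) \<and> a \<subseteq> \<A> \<and> |a| <o \<kappa>}"
  have base: "\<exists>B\<in>\<B>. B \<subseteq> \<Inter>\<C>" if C: "\<C> \<subseteq> \<B>" "|\<C>| <o \<kappa>" for \<C>
  proof -
    have "\<forall>D\<in>\<C>. \<exists>B a. D = B \<inter> C a p \<and> (\<forall>\<^sub>F z in F. z \<in> B) \<and> a \<subseteq> \<A> \<and> |a| <o \<kappa>"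
      using C(1) unfolding \<B>_def by blast
    then obtain b a where ba: "\<And>D. D \<in> \<C> \<Longrightarrow> D = b D \<inter> C (a D) p \<and> (\<forall>\<^sub>F z in F. z \<in> b D) \<and>
        a D \<subseteq> \<A> \<and> |a D| <o \<kappa>"
      by metis
    let ?B = "{z. \<forall>D\<in>\<C>. z \<in> b D}" and ?a = "\<Union>D\<in>\<C>. a D"
    have "\<forall>\<^sub>F z in F. z \<in> ?B"
      using lt_complete_filter_eventually_ball[OF F(3) C(2), of "\<lambda>D z. z \<in> b D"] ba by simp
    \<comment> \<open>Regularity enters here: fewer than \<open>\<kappa>\<close> small sets of
      prescriptions are merged into one small set.\<close>
    moreover have "|?a| <o \<kappa>" using stable_UNION[OF st C(2), of a] ba by blast
    moreover have "?a \<subseteq> \<A>" using ba by blast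
    ultimately have "?B \<inter> C ?a p \<in> \<B>" unfolding \<B>_def by blast
    moreover have "?B \<inter> C ?a p \<subseteq> D" if "D \<in> \<C>" for D
    proof -
      have "?B \<inter> C ?a p \<subseteq> b D \<inter> C (a D) p" using that by (auto simp: C_def)
      then show ?thesis using ba[OF that] by simp
    qed
    ultimately show ?thesis by (meson Inter_greatest)
  qed
  let ?G = "INF B\<in>\<B>. principal B"
  have ev: "eventually P ?G \<longleftrightarrow> (\<exists>B\<in>\<B>. \<forall>z\<in>B. P z)" for P
    by (rule eventually_INF_lt_complete_base[OF \<kappa> base])
  have ev_I: "eventually P ?G" if "\<forall>\<^sub>F z in F. z \<in> B" "a \<subseteq> \<A>" "finite a" "\<And>z. z \<in> B \<inter> C a p \<Longrightarrow> P z"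
    for P B a
    unfolding ev unfolding \<B>_def using that finite_card_of_ordLess[OF \<kappa> that(3)] by blast
  show "\<exists>G. G \<le> F \<and> G \<noteq> bot \<and> lt_complete_filter \<kappa> G \<and> measures_family ?S G \<A>"
  proof (intro exI[of _ ?G] conjI)
    show "?G \<le> F"
    proof (rule filter_leI)
      fix P assume "eventually P F"
      then show "eventually P ?G"
        by (intro ev_I[of "Collect P" "{}"]) auto
    qed
    show "?G \<noteq> bot"
    proof
      assume "?G = bot"
      then have "eventually (\<lambda>_. False) ?G" by simp
      then obtain B a where "\<forall>\<^sub>F z in F. z \<in> B" "a \<subseteq> \<A>" "|a| <o \<kappa>" "B \<inter> C a p = {}"
        unfolding ev unfolding \<B>_def by blast
      then have "\<forall>\<^sub>F z in F. z \<notin> C a p" by (auto elim: eventually_mono)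
      then show False using p \<open>a \<subseteq> \<A>\<close> \<open>|a| <o \<kappa>\<close> by blast
    qed
    show "lt_complete_filter \<kappa> ?G" by (rule lt_complete_filter_INF[OF \<kappa> base])
    show "measures_family ?S ?G \<A>"
      unfolding measures_family_def
    proof
      fix A assume "A \<in> \<A>"
      have S: "\<forall>\<^sub>F z in F. z \<in> ?S" using F(1) by (simp add: le_principal)
      show "(\<forall>\<^sub>F z in ?G. z \<in> A) \<or> (\<forall>\<^sub>F z in ?G. z \<in> ?S - A)"
      proof (cases "p (e A) = x")
        case True
        then have "\<forall>\<^sub>F z in ?G. z \<in> A"
          using \<open>A \<in> \<A>\<close> by (intro ev_I[OF S, of "{A}"]) (auto simp: C_def)
        then show ?thesis ..
      next
        case False
        then have "\<forall>\<^sub>F z in ?G. z \<in> ?S - A"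
          using \<open>A \<in> \<A>\<close> by (intro ev_I[OF S, of "{A}"]) (auto simp: C_def)
        then show ?thesis ..
      qed
    qed
  qed
qed

section \<open>From filter extension to compact box products\<close>

text \<open>An open cover may have more than \<open>\<Lambda>\<close> members. Refining it to boxes
  built from the chosen bases leaves at most \<open>\<Lambda>\<close> boxes, which brings it within
  reach of the filter extension property.\<close>

lemma lt_compact_box_topology:
  fixes \<kappa> :: "'k rel" and \<Lambda> :: "'l rel" and X :: "'i \<Rightarrow> 'x topology"
  assumes \<kappa>: "Cinfinite \<kappa>" and \<Lambda>: "Cinfinite \<Lambda>" and cexp: "cexp_less \<Lambda> \<kappa> =o \<Lambda>"
    and fep: "filter_extension_property \<kappa> \<Lambda>"
    and I: "|I| \<le>o \<Lambda>" and compact: "\<And>i. i \<in> I \<Longrightarrow> lt_compact_space \<kappa> (X i)"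
    and weight: "\<And>i. i \<in> I \<Longrightarrow> weight (X i) \<le>o \<Lambda>"
  shows "lt_compact_space \<kappa> (box_topology \<kappa> X I)"
proof -
  have st: "stable \<kappa>" by (rule stable_if_filter_extension_property[OF \<kappa> \<Lambda> cexp fep])
  define Y where "Y = (\<Pi>\<^sub>E i\<in>I. topspace (X i))"
  have top: "topspace (box_topology \<kappa> X I) = Y"
    unfolding Y_def by (rule topspace_box_topology[OF \<kappa>])
  have "\<forall>i\<in>I. \<exists>\<B>. base_of (X i) \<B> \<and> |\<B>| \<le>o \<Lambda>"
    using weight unfolding weight_ordLeq_iff by blast
  then obtain b where b: "\<And>i. i \<in> I \<Longrightarrow> base_of (X i) (b i)" "\<And>i. i \<in> I \<Longrightarrow> |b i| \<le>o \<Lambda>"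
    by metis
  define P where "P = Sigma I b"
  have P_le: "|P| \<le>o \<Lambda>"
    unfolding P_def using \<Lambda> I b(2)
    by (intro card_of_Sigma_ordLeq_infinite_Field) (auto simp: cinfinite_def)
  define cyl where "cyl c = {x \<in> Y. x (fst c) \<in> snd c}" for c :: "'i \<times> 'x set"
  \<comment> \<open>A small set \<open>s\<close> of pairs from \<open>P\<close> codes a basic box as
    an intersection of cylinders.\<close>
  define box where "box s = {x \<in> Y. \<forall>c\<in>s. x (fst c) \<in> snd c}" for s :: "('i \<times> 'x set) set"
  show ?thesis
    unfolding lt_compact_space_def top
  proof (intro allI impI, elim conjE)
    fix \<U> assume U: "\<forall>U\<in>\<U>. openin (box_topology \<kappa> X I) U" "\<Union>\<U> = Y"
    define \<S> where "\<S> = {s. s \<subseteq> P \<and> |s| <o \<kappa> \<and> (\<exists>U\<in>\<U>. box s \<subseteq> U)}"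
    have S_cover: "\<exists>s\<in>\<S>. x \<in> box s" if x: "x \<in> Y" for x
    proof -
      obtain U where U': "U \<in> \<U>" "x \<in> U" using U(2) x by blast
      then obtain S where S: "S \<in> box_base \<kappa> X I" "x \<in> S" "S \<subseteq> U"
        using base_ofE[OF base_of_box_topology[OF \<kappa>]] U(1) by blast
      then obtain V where V: "S = (\<Pi>\<^sub>E i\<in>I. V i)" "\<And>i. i \<in> I \<Longrightarrow> openin (X i) (V i)"
          "|{i\<in>I. V i \<noteq> topspace (X i)}| <o \<kappa>"
        unfolding box_base_def by blast
      have "\<exists>W. W \<in> b i \<and> x i \<in> W \<and> W \<subseteq> V i" if "i \<in> I" for i
      proof -
        have "x i \<in> V i" using S(2) that unfolding V(1) by (rule PiE_mem)
        then show ?thesis using base_ofE[OF b(1)[OF that] V(2)[OF that]] by blast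
      qed
      then obtain W where W: "\<And>i. i \<in> I \<Longrightarrow> W i \<in> b i \<and> x i \<in> W i \<and> W i \<subseteq> V i" by metis
      let ?J = "{i\<in>I. V i \<noteq> topspace (X i)}"
      \<comment> \<open>Coordinates with a full factor are left out, so that the code is
        small.\<close>
      let ?s = "(\<lambda>i. (i, W i)) ` ?J"
      have "box ?s \<subseteq> S"
      proof
        fix z assume z: "z \<in> box ?s"
        have "z i \<in> V i" if "i \<in> I" for i
        proof (cases "V i = topspace (X i)")
          case True
          have "z i \<in> topspace (X i)"
            using z that unfolding box_def Y_def by (blast intro: PiE_mem)
          then show ?thesis using True by simp
        next
          case False
          then have "z i \<in> W i" using z that unfolding box_def by auto
          then show ?thesis using W[OF that] by blast
        qed
        then show "z \<in> S" using z unfolding V(1) box_def Y_def by (simp add: PiE_iff)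
      qed
      then have "?s \<in> \<S>"
        unfolding \<S>_def P_def using W S(3) U'(1) card_of_image_ordLess[OF V(3)] by blast
      moreover have "x \<in> box ?s" using W x by (auto simp: box_def)
      ultimately show ?thesis by blast
    qed
    have S_le: "|\<S>| \<le>o \<Lambda>"
    proof -
      have "\<S> \<subseteq> {s. s \<subseteq> P \<and> |s| <o \<kappa>}" by (auto simp: \<S>_def)
      then show ?thesis
        using card_of_small_subsets_ordLeq[OF \<kappa> \<Lambda> cexp P_le] card_of_mono1 ordLeq_transitive
        by blast
    qed
    show "\<exists>\<V>\<subseteq>\<U>. |\<V>| <o \<kappa> \<and> \<Union>\<V> = Y"
    proof (rule ccontr)
      assume no_subcover: "\<not> ?thesis"
      \<comment> \<open>The part of the product left uncovered by the boxes in \<open>t\<close>; it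
        is nonempty for small \<open>t\<close>, since each box in \<open>t\<close> lies in a member
        of the cover.\<close>
      define r where "r t = Y - \<Union>(box ` t)" for t
      define \<B> where "\<B> = r ` {t. t \<subseteq> \<S> \<and> |t| <o \<kappa>}"
      have \<B>_Pow: "\<B> \<subseteq> Pow Y" by (auto simp: \<B>_def r_def)
      have \<B>_ne: "{} \<notin> \<B>"
      proof
        assume "{} \<in> \<B>"
        then obtain t where t: "t \<subseteq> \<S>" "|t| <o \<kappa>" "r t = {}" unfolding \<B>_def by auto
        have "\<forall>s\<in>t. \<exists>U. U \<in> \<U> \<and> box s \<subseteq> U" using t(1) unfolding \<S>_def by blast
        then obtain u where u: "\<And>s. s \<in> t \<Longrightarrow> u s \<in> \<U> \<and> box s \<subseteq> u s" by metis
        have "Y \<subseteq> \<Union>(u ` t)" using t(3) u unfolding r_def by blast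
        moreover have "\<Union>(u ` t) \<subseteq> Y" using u U(2) by blast
        moreover have "|u ` t| <o \<kappa>" by (rule card_of_image_ordLess[OF t(2)])
        moreover have "u ` t \<subseteq> \<U>" using u by blast
        ultimately show False using no_subcover by (metis subset_antisym)
      qed
      have \<B>_le: "|\<B>| \<le>o \<Lambda>"
        unfolding \<B>_def
        using card_of_image card_of_small_subsets_ordLeq[OF \<kappa> \<Lambda> cexp S_le] ordLeq_transitive
        by blast
      have base: "\<exists>B\<in>\<B>. B \<subseteq> \<Inter>\<C>" if C: "\<C> \<subseteq> \<B>" "|\<C>| <o \<kappa>" for \<C>
      proof -
        have "\<forall>B\<in>\<C>. \<exists>t. B = r t \<and> t \<subseteq> \<S> \<and> |t| <o \<kappa>" using C(1) unfolding \<B>_def by blast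
        then obtain t where t: "\<And>B. B \<in> \<C> \<Longrightarrow> B = r (t B) \<and> t B \<subseteq> \<S> \<and> |t B| <o \<kappa>" by metis
        let ?t = "\<Union>B\<in>\<C>. t B"
        have "|?t| <o \<kappa>" using stable_UNION[OF st C(2), of t] t by blast
        moreover have "?t \<subseteq> \<S>" using t by blast
        ultimately have "r ?t \<in> \<B>" unfolding \<B>_def by blast
        moreover have "r ?t \<subseteq> B" if "B \<in> \<C>" for B
        proof -
          have "r ?t \<subseteq> r (t B)" using that by (auto simp: r_def)
          then show ?thesis using t[OF that] by simp
        qed
        ultimately show ?thesis by (meson Inter_greatest)
      qed
      have cyl_Pow: "cyl ` P \<subseteq> Pow Y" by (auto simp: cyl_def)
      have cyl_le: "|cyl ` P| \<le>o \<Lambda>" using card_of_image P_le ordLeq_transitive by blast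
      obtain G where G: "G \<noteq> bot" "lt_complete_filter \<kappa> G" "\<And>B. B \<in> \<B> \<Longrightarrow> \<forall>\<^sub>F x in G. x \<in> B"
          "measures_family Y G (cyl ` P)"
        using filter_extension_property_transfer[OF \<kappa> \<Lambda> fep \<B>_Pow \<B>_ne \<B>_le base cyl_Pow cyl_le]
        by blast
      have "r {} \<in> \<B>"
        unfolding \<B>_def using finite_card_of_ordLess[OF \<kappa> finite.emptyI] by blast
      then have G_Y: "\<forall>\<^sub>F x in G. x \<in> Y" using G(3)[of "r {}"] by (simp add: r_def)
      have not_False: "\<not> (\<forall>\<^sub>F x in G. False)" using G(1) by (simp add: trivial_limit_def)
      have "\<exists>z\<in>topspace (X i). \<forall>V\<in>b i. z \<in> V \<longrightarrow> (\<forall>\<^sub>F x in G. x \<in> cyl (i, V))" if i: "i \<in> I" for i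
      proof (rule ccontr)
        assume "\<not> ?thesis"
        then have bad: "\<exists>V\<in>b i. z \<in> V \<and> \<not> (\<forall>\<^sub>F x in G. x \<in> cyl (i, V))"
          if "z \<in> topspace (X i)" for z using that by blast
        \<comment> \<open>If no point of the factor is a limit, these sets cover it. Fewer than
          \<open>\<kappa>\<close> of them suffice, and since \<open>G\<close> measures their
          cylinders, completeness would leave no value for coordinate \<open>i\<close>.\<close>
        define \<W> where "\<W> = {V \<in> b i. \<not> (\<forall>\<^sub>F x in G. x \<in> cyl (i, V))}"
        have W_open: "\<forall>V\<in>\<W>. openin (X i) V"
          using base_of_imp_openin[OF b(1)[OF i]] by (simp add: \<W>_def)
        have "\<Union>\<W> = topspace (X i)"
        proof
          show "\<Union>\<W> \<subseteq> topspace (X i)" using W_open openin_subset by (intro Union_least) blast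
          show "topspace (X i) \<subseteq> \<Union>\<W>" using bad by (auto simp: \<W>_def)
        qed
        then obtain \<V> where V: "\<V> \<subseteq> \<W>" "|\<V>| <o \<kappa>" "\<Union>\<V> = topspace (X i)"
          using compact[OF i, unfolded lt_compact_space_def, rule_format, of \<W>] W_open by blast
        have "\<forall>\<^sub>F x in G. x i \<notin> V" if V': "V \<in> \<V>" for V
        proof -
          have "(i, V) \<in> P" and null: "\<not> (\<forall>\<^sub>F x in G. x \<in> cyl (i, V))"
            using V(1) V' i by (auto simp: \<W>_def P_def)
          then have "\<forall>\<^sub>F x in G. x \<in> Y - cyl (i, V)"
            using G(4) unfolding measures_family_def by blast
          then show ?thesis by (rule eventually_mono) (simp add: cyl_def)
        qed
        then have "\<forall>\<^sub>F x in G. \<forall>V\<in>\<V>. x i \<notin> V"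
          by (rule lt_complete_filter_eventually_ball[OF G(2) V(2)])
        with G_Y have "\<forall>\<^sub>F x in G. False"
        proof eventually_elim
          case (elim x)
          have "x i \<in> topspace (X i)" using elim(1) i unfolding Y_def by (rule PiE_mem)
          then show False using elim(2) unfolding V(3)[symmetric] by blast
        qed
        then show False using not_False by blast
      qed
      then obtain z where z: "\<And>i. i \<in> I \<Longrightarrow> z i \<in> topspace (X i)"
          "\<And>i V. i \<in> I \<Longrightarrow> V \<in> b i \<Longrightarrow> z i \<in> V \<Longrightarrow> \<forall>\<^sub>F x in G. x \<in> cyl (i, V)"
        by metis
      have "restrict z I \<in> Y" using z(1) by (auto simp: Y_def)
      then obtain s where s: "s \<in> \<S>" "restrict z I \<in> box s" using S_cover by blast
      have "\<forall>\<^sub>F x in G. x (fst c) \<in> snd c" if c: "c \<in> s" for c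
      proof -
        obtain i V where iV: "c = (i, V)" "i \<in> I" "V \<in> b i"
          using s(1) c unfolding \<S>_def P_def by blast
        have "z i \<in> V" using s(2) c iV unfolding box_def by force
        then have "\<forall>\<^sub>F x in G. x \<in> cyl (i, V)" by (rule z(2)[OF iV(2,3)])
        then show ?thesis by (rule eventually_mono) (simp add: cyl_def iV(1))
      qed
      \<comment> \<open>The coordinatewise limit lies in the box coded by \<open>s\<close>, so this
        box is a member of \<open>G\<close> as an intersection of few cylinders; but
        \<open>r {s}\<close>, which is disjoint from it, is a member too.\<close>
      then have ev_s: "\<forall>\<^sub>F x in G. \<forall>c\<in>s. x (fst c) \<in> snd c"
        using s(1) unfolding \<S>_def by (intro lt_complete_filter_eventually_ball[OF G(2)]) auto
      have "r {s} \<in> \<B>"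
        unfolding \<B>_def using s(1) finite_card_of_ordLess[OF \<kappa>, of "{s}"] by blast
      then have "\<forall>\<^sub>F x in G. x \<in> r {s}" by (rule G(3))
      with ev_s have "\<forall>\<^sub>F x in G. False"
        by eventually_elim (simp add: r_def box_def)
      then show False using not_False by blast
    qed
  qed
qed

section \<open>Finite factors and the equivalence of the three conditions\<close>

lemma lt_compact_space_finite:
  assumes "Cinfinite \<kappa>" "finite (topspace X)"
  shows "lt_compact_space \<kappa> X"
  unfolding lt_compact_space_def
proof (intro allI impI, elim conjE)
  fix \<U> assume "\<forall>U\<in>\<U>. openin X U" "\<Union>\<U> = topspace X"
  then have "finite \<U>" using assms(2) finite_UnionD by metis
  then show "\<exists>\<V>\<subseteq>\<U>. |\<V>| <o \<kappa> \<and> \<Union>\<V> = topspace X"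
    using finite_card_of_ordLess[OF assms(1)] \<open>\<Union>\<U> = topspace X\<close> by blast
qed

lemma weight_ordLeq_finite:
  assumes "Cinfinite \<Lambda>" "finite (topspace X)"
  shows "weight X \<le>o \<Lambda>"
proof -
  have "{U. openin X U} \<subseteq> Pow (topspace X)" using openin_subset by blast
  then have "finite {U. openin X U}" using assms(2) finite_subset by blast
  then show ?thesis
    unfolding weight_ordLeq_iff
    using base_of_openin finite_card_of_ordLess[OF assms(1)] ordLess_imp_ordLeq by blast
qed

theorem theorem3p2:
  fixes \<kappa> :: "'k rel" and \<Lambda> :: "'l rel"
  assumes "Cinfinite \<kappa>" and "Cinfinite \<Lambda>"
    and "cexp_less \<Lambda> \<kappa> =o \<Lambda>"
    and "\<exists>x y :: 'x. x \<noteq> y"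
  shows "(filter_extension_property \<kappa> \<Lambda> \<longleftrightarrow> box_products_lt_compact TYPE('x) \<kappa> \<Lambda>) \<and>
         (filter_extension_property \<kappa> \<Lambda> \<longleftrightarrow>
            lt_compact_space \<kappa>
              (box_topology \<kappa> (\<lambda>_. discrete_topology (UNIV :: bool set)) (Field \<Lambda>)))"
proof -
  note \<kappa> = assms(1) and \<Lambda> = assms(2) and cexp = assms(3)
  have le: "\<kappa> \<le>o \<Lambda>" by (rule ordLeq_if_cexp_less_eq[OF \<kappa> \<Lambda> cexp])
  have Field_le: "|Field \<Lambda>| \<le>o \<Lambda>"
    using \<Lambda> card_of_Field_ordIso ordIso_imp_ordLeq by blast
  have UNIV_bool': "(UNIV :: bool set) = {True, False}" by auto
  have products: "box_products_lt_compact TYPE('x) \<kappa> \<Lambda>" if "filter_extension_property \<kappa> \<Lambda>"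
    unfolding box_products_lt_compact_def
    using lt_compact_box_topology[OF \<kappa> \<Lambda> cexp that] by blast
  have power: "lt_compact_space \<kappa>
      (box_topology \<kappa> (\<lambda>_. discrete_topology (UNIV :: bool set)) (Field \<Lambda>))"
    if "filter_extension_property \<kappa> \<Lambda>"
    by (intro lt_compact_box_topology[OF \<kappa> \<Lambda> cexp that Field_le]
        lt_compact_space_finite[OF \<kappa>] weight_ordLeq_finite[OF \<Lambda>]) auto
  have "filter_extension_property \<kappa> \<Lambda>" if prod: "box_products_lt_compact TYPE('x) \<kappa> \<Lambda>"
  proof -
    \<comment> \<open>Two distinct points of \<open>'x\<close> carry a copy of the discrete
      two-point space, so a copy of the power of two is among the products.\<close>
    obtain x y :: 'x where xy: "x \<noteq> y" using assms(4) by blast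
    have "lt_compact_space \<kappa> (box_topology \<kappa> (\<lambda>_. discrete_topology {x, y}) (Field \<Lambda>))"
      by (intro prod[unfolded box_products_lt_compact_def, rule_format] conjI ballI Field_le
          Hausdorff_space_discrete_topology lt_compact_space_finite[OF \<kappa>]
          weight_ordLeq_finite[OF \<Lambda>]) auto
    then show ?thesis
      using filter_extension_property_if_lt_compact_power[OF \<kappa> \<Lambda> _ xy]
        stable_if_lt_compact_power[OF \<kappa> \<Lambda> le xy] by blast
  qed
  moreover have "filter_extension_property \<kappa> \<Lambda>" if "lt_compact_space \<kappa>
      (box_topology \<kappa> (\<lambda>_. discrete_topology (UNIV :: bool set)) (Field \<Lambda>))"
    using filter_extension_property_if_lt_compact_power[OF \<kappa> \<Lambda> _ True_not_False]
      stable_if_lt_compact_power[OF \<kappa> \<Lambda> le True_not_False] that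
    unfolding UNIV_bool' by blast
  ultimately show ?thesis using products power by blast
qed

end
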